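(* Let $\mathcal{X}$ be a finite set, $\mathcal{F} \subseteq \{\mathcal{X}\to[0,1]\}$, $\mathcal{D}_0, \mathcal{D}_1$ distributions on $\mathcal{X}$, $\varepsilon \in (0,1)$, $\gamma \in (0, \varepsilon/2)$, $h : \mathcal{X}\to[0,1]$, and $k\in\mathbb{N}$. Let $\mathcal{D}_\mathcal{X} = (1-\varepsilon)\mathcal{D}_0 + \varepsilon\mathcal{D}_1$ and $g = \frac{\varepsilon\mathcal{D}_1}{(1-\varepsilon)\mathcal{D}_0 + \varepsilon\mathcal{D}_1}$ on the support of $\mathcal{D}_\mathcal{X}$. Consider the joint distribution of $(x,\tilde y)$ where $x \sim \mathcal{D}_\mathcal{X}$ and $\tilde y\mid x \sim \mathcal{B}(h(x))$, and let $\widetilde{\mathcal{D}}_1$ be the conditional distribution of $x$ given $\tilde y = 1$. Suppose $h$ is an $(\mathcal{F},\varepsilon^2)$-regular and $\gamma$-calibrated simulator for $g$ under $\mathcal{D}_\mathcal{X}$. Then: (i) $\mathcal{D}_1$ and $\widetilde{\mathcal{D}}_1$ are $\bigl(\mathcal{F}, \varepsilon + \frac{2\gamma}{\varepsilon^2}\bigr)$-indistinguishable; (ii) the function $h' : \mathcal{X}^k\to\{0,1\}$, $h'(z_1,\dots,z_k) = \mathbf{1}\bigl[\prod_{i=1}^k h(z_i) > \varepsilon^k\bigr]$ satisfies \[ \Bigl|\mathbb{E}_{z\sim \mathcal{D}_0^{\otimes k}}[h'(z)] - \mathbb{E}_{z\sim\mathcal{D}_1^{\otimes k}}[h'(z)]\Bigr|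 \ge d_{\mathrm{TV}}(\mathcal{D}_0^{\otimes k}, \widetilde{\mathcal{D}}_1^{\otimes k}) - \Bigl(\frac{2\gamma}{\varepsilon^2} + \frac{\gamma}{\varepsilon} + \varepsilon\Bigr)k. \]
   Context: $\mathcal{B}(p)$ is the Bernoulli distribution with parameter $p$. A function $h$ is an $(\mathcal{F},\delta)$-regular simulator for $g$ under $\mathcal{D}$ if $|\mathbb{E}_{x\sim\mathcal{D}}[f(x)(g(x)-h(x))]| \le \delta$ for all $f\in\mathcal{F}$; it is $\gamma$-calibrated (for $g$ under $\mathcal{D}$) if $|\mathbb{E}_{x\sim\mathcal{D}}[w(h(x))(g(x)-h(x))]| \le \gamma$ for every function $w : [0,1]\to[0,1]$. Two distributions $P,Q$ on $\mathcal{X}$ are $(\mathcal{F},\delta)$-indistinguishable if $|\mathbb{E}_{x\sim P}[f(x)] - \mathbb{E}_{x\sim Q}[f(x)]| \le \delta$ for all $f\in\mathcal{F}$. $\mathcal{D}^{\otimes k}$ is the $k$-fold product distribution and $d_{\mathrm{TV}}$ the total variation distance. *)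

theory Defs
  imports "HOL-Probability.Probability" "HOL-Probability.Product_PMF"
begin

definition regular_simulator ::
  "('a \<Rightarrow> real) set \<Rightarrow> real \<Rightarrow> 'a pmf \<Rightarrow> ('a \<Rightarrow> real) \<Rightarrow> ('a \<Rightarrow> real) \<Rightarrow> bool" where
  "regular_simulator F \<delta> D g h \<longleftrightarrow>
     (\<forall>f\<in>F. \<bar>measure_pmf.expectation D (\<lambda>x. f x * (g x - h x))\<bar> \<le> \<delta>)"

definition calibrated_simulator ::
  "real \<Rightarrow> 'a pmf \<Rightarrow> ('a \<Rightarrow> real) \<Rightarrow> ('a \<Rightarrow> real) \<Rightarrow> bool" where
  "calibrated_simulator \<gamma> D g h \<longleftrightarrow>
     (\<forall>w \<in> {0..1} \<rightarrow> {0..1}.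
        \<bar>measure_pmf.expectation D (\<lambda>x. w (h x) * (g x - h x))\<bar> \<le> \<gamma>)"

definition indistinguishable ::
  "('a \<Rightarrow> real) set \<Rightarrow> real \<Rightarrow> 'a pmf \<Rightarrow> 'a pmf \<Rightarrow> bool" where
  "indistinguishable F \<delta> P Q \<longleftrightarrow>
     (\<forall>f\<in>F. \<bar>measure_pmf.expectation P f - measure_pmf.expectation Q f\<bar> \<le> \<delta>)"

definition tv_dist :: "'a pmf \<Rightarrow> 'a pmf \<Rightarrow> real" where
  "tv_dist P Q = (SUP A. \<bar>measure_pmf.prob P A - measure_pmf.prob Q A\<bar>)"

text \<open>The mixture \<open>(1 - \<epsilon>) P + \<epsilon> Q\<close>, for \<open>\<epsilon>\<close> in the unit interval.\<close>
definition mixture_pmf :: "real \<Rightarrow> 'a pmf \<Rightarrow> 'a pmf \<Rightarrow> 'a pmf" where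
  "mixture_pmf \<epsilon> P Q = bind_pmf (bernoulli_pmf \<epsilon>) (\<lambda>b. if b then Q else P)"

text \<open>The outcome \<open>True\<close> of \<^const>\<open>bernoulli_pmf\<close> stands for the label 1.\<close>
definition labelled_pmf :: "'a pmf \<Rightarrow> ('a \<Rightarrow> real) \<Rightarrow> ('a \<times> bool) pmf" where
  "labelled_pmf D h = bind_pmf D (\<lambda>x. map_pmf (\<lambda>y. (x, y)) (bernoulli_pmf (h x)))"

text \<open>Conditional law of \<open>x\<close> given label 1; meaningful only if that label has positive
  probability, since \<^const>\<open>cond_pmf\<close> is unspecified when conditioning on a null event.\<close>
definition positive_pmf :: "'a pmf \<Rightarrow> ('a \<Rightarrow> real) \<Rightarrow> 'a pmf" where
  "positive_pmf D h = map_pmf fst (cond_pmf (labelled_pmf D h) {(x, y). y})"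

text \<open>A tuple of length \<open>k\<close> is a function on \<^typ>\<open>nat\<close> restricted to \<open>{..<k}\<close>;
  outside this set the product distribution is constantly \<^const>\<open>undefined\<close>.\<close>
definition power_pmf :: "nat \<Rightarrow> 'a pmf \<Rightarrow> (nat \<Rightarrow> 'a) pmf" where
  "power_pmf k D = Pi_pmf {..<k} undefined (\<lambda>_. D)"

definition threshold_test :: "('a \<Rightarrow> real) \<Rightarrow> real \<Rightarrow> nat \<Rightarrow> (nat \<Rightarrow> 'a) \<Rightarrow> real" where
  "threshold_test h \<epsilon> k z = of_bool ((\<Prod>i<k. h (z i)) > \<epsilon> ^ k)"

end

theory Submission
  imports Defs
begin

text \<open>
  Write \<open>p\<close> for the mean of \<open>h\<close> under \<open>DX\<close>. Since \<open>D1 = DX g / \<epsilon>\<close> and \<open>D1' = DX h / p\<close>, and calibration with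
  \<open>w = 1\<close> gives \<open>\<bar>p - \<epsilon>\<bar> \<le> \<gamma>\<close>, regularity yields indistinguishability, while calibration shows that \<open>D1\<close> and
  \<open>D1'\<close> differ by at most \<open>2 \<gamma> / \<epsilon>\<close> on events depending on \<open>h\<close> only.

  Let \<open>A\<close> be the acceptance event of the test. Up to the error \<open>k \<gamma> / \<epsilon>\<close> caused by \<open>p \<noteq> \<epsilon>\<close>, it is the
  likelihood ratio test of \<open>D1'\<close> against \<open>DX\<close> (not \<open>D0\<close>). Replacing \<open>D0\<close> by \<open>DX\<close> in the total variation distance
  costs \<open>k \<epsilon>\<close>. Going back from \<open>DX\<close> to \<open>D0\<close> on \<open>A\<close> must not cost another \<open>k \<epsilon>\<close>: on events depending on \<open>h\<close>
  only, \<open>D0\<close> is close to a multiple of \<open>DX (1 - h)\<close>, whose \<open>k\<close>-fold product is dominated by that of \<open>DX\<close> on \<open>A\<close>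
  because \<open>\<Prod>h(z\<^sub>i) > \<epsilon>\<^sup>k\<close> forces \<open>\<Prod>(1 - h(z\<^sub>i)) \<le> (1 - \<epsilon>)\<^sup>k\<close>.
\<close>

section \<open>Point masses of the mixture, the labelled law and the conditional law\<close>

lemma expectation_pmf_finite:
  fixes f :: "'a::finite \<Rightarrow> real"
  shows "measure_pmf.expectation D f = (\<Sum>x\<in>UNIV. pmf D x * f x)"
  by (subst integral_measure_pmf[of UNIV]) auto

lemma sum_pmf_UNIV: "(\<Sum>x\<in>UNIV. pmf (D :: 'a::finite pmf) x) = 1"
  by (rule sum_pmf_eq_1) auto

lemma pmf_mixture:
  assumes "0 \<le> \<epsilon>" "\<epsilon> \<le> 1"
  shows "pmf (mixture_pmf \<epsilon> P Q) x = (1 - \<epsilon>) * pmf P x + \<epsilon> * pmf Q x"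
  using assms by (simp add: mixture_pmf_def pmf_bind)

lemma pmf_labelled_True:
  fixes D :: "'a::finite pmf"
  assumes "h \<in> UNIV \<rightarrow> {0..1}"
  shows "pmf (labelled_pmf D h) (x, True) = pmf D x * h x"
proof -
  have h: "0 \<le> h y" "h y \<le> 1" for y using assms by auto
  have eq: "pmf (map_pmf (\<lambda>b. (y, b)) (bernoulli_pmf (h y))) (x, True) = (if y = x then h x else 0)" for y
  proof (cases "y = x")
    case True
    have "inj (\<lambda>b::bool. (y, b))" by (auto intro: injI)
    from pmf_map_inj'[OF this, of "bernoulli_pmf (h y)" True] show ?thesis
      using True h by simp
  next
    case False
    then show ?thesis by (auto intro!: pmf_map_outside)
  qed
  show ?thesis
    unfolding labelled_pmf_def pmf_bind eq expectation_pmf_finite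
    by (simp add: if_distrib[of "(*) _"] cong: if_cong)
qed

text \<open>The mean of \<open>h\<close> is the probability of label 1. Its positivity makes the
  conditioning event non-null, so that \<open>cond_pmf\<close> is specified.\<close>

lemma pmf_positive:
  fixes D :: "'a::finite pmf"
  assumes h: "h \<in> UNIV \<rightarrow> {0..1}"
    and pos: "0 < measure_pmf.expectation D h"
  shows "pmf (positive_pmf D h) x = pmf D x * h x / measure_pmf.expectation D h"
proof -
  let ?L = "labelled_pmf D h" and ?S = "{(x::'a, y). y}"
  have "?S = range (\<lambda>x. (x, True))" by auto
  then have "measure_pmf.prob ?L ?S = (\<Sum>x\<in>UNIV. pmf ?L (x, True))"
    by (simp add: measure_measure_pmf_finite sum.reindex inj_on_def)
  then have prob: "measure_pmf.prob ?L ?S = measure_pmf.expectation D h"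
    using h by (simp add: pmf_labelled_True expectation_pmf_finite)
  have ne: "set_pmf ?L \<inter> ?S \<noteq> {}"
    using pos prob measure_pmf_zero_iff[of ?L ?S] by auto
  have "fst -` {x} = {(x, True), (x, False)}" by auto
  then have "pmf (positive_pmf D h) x
      = pmf (cond_pmf ?L ?S) (x, True) + pmf (cond_pmf ?L ?S) (x, False)"
    unfolding positive_pmf_def pmf_map by (simp add: measure_measure_pmf_finite)
  then show ?thesis using h prob by (simp add: pmf_cond[OF ne] pmf_labelled_True)
qed

section \<open>Sums over \<open>k\<close>-tuples and the hybrid argument\<close>

text \<open>Arbitrary real weights \<open>q\<close> are allowed instead of a \<open>pmf\<close>,
  because one of the measures compared later has total mass at most 1 only.\<close>

definition product_sum :: "nat \<Rightarrow> ('a::finite \<Rightarrow> real) \<Rightarrow> ((nat \<Rightarrow> 'a) \<Rightarrow> real) \<Rightarrow> real" where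
  "product_sum k q \<phi> = (\<Sum>z\<in>PiE {..<k} (\<lambda>_. UNIV). (\<Prod>i<k. q (z i)) * \<phi> z)"

lemma expectation_power_pmf:
  fixes D :: "'a::finite pmf"
  shows "measure_pmf.expectation (power_pmf k D) \<phi> = product_sum k (pmf D) \<phi>"
proof -
  let ?T = "PiE {..<k} (\<lambda>_. UNIV :: 'a set)"
  have supp: "z \<in> ?T" if "z \<in> set_pmf (power_pmf k D)" for z
    using set_Pi_pmf_subset[of "{..<k}" undefined "\<lambda>_. D"] that
    by (auto simp: power_pmf_def PiE_def extensional_def)
  have "measure_pmf.expectation (power_pmf k D) \<phi> = (\<Sum>z\<in>?T. pmf (power_pmf k D) z * \<phi> z)"
    using supp by (subst integral_measure_pmf[of ?T]) (auto intro: finite_PiE)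
  also have "\<dots> = product_sum k (pmf D) \<phi>"
    unfolding product_sum_def power_pmf_def
    by (intro sum.cong refl) (subst pmf_Pi', auto simp: PiE_def extensional_def)
  finally show ?thesis .
qed

lemma product_sum_0: "product_sum 0 q \<phi> = \<phi> (\<lambda>_. undefined)"
  by (simp add: product_sum_def)

lemma product_sum_Suc:
  "product_sum (Suc k) q \<phi> = product_sum k q (\<lambda>z. \<Sum>x\<in>UNIV. q x * \<phi> (z(k := x)))"
proof -
  let ?T = "PiE {..<k} (\<lambda>_. UNIV :: 'a set)"
  let ?F = "\<lambda>z. (\<Prod>i<Suc k. q (z i)) * \<phi> z"
  have "product_sum (Suc k) q \<phi> = (\<Sum>z\<in>(\<lambda>(y, g). g(k := y)) ` (UNIV \<times> ?T). ?F z)"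
    by (simp add: product_sum_def lessThan_Suc PiE_insert_eq)
  also have "\<dots> = (\<Sum>(y, g)\<in>UNIV \<times> ?T. ?F (g(k := y)))"
    using inj_combinator[of k "{..<k}" "\<lambda>_. UNIV"] by (subst sum.reindex) (auto simp: case_prod_beta)
  also have "\<dots> = (\<Sum>y\<in>UNIV. \<Sum>g\<in>?T. ?F (g(k := y)))"
    by (rule sum.cartesian_product[symmetric])
  also have "\<dots> = (\<Sum>g\<in>?T. \<Sum>y\<in>UNIV. ?F (g(k := y)))"
    by (rule sum.swap)
  also have "\<dots> = product_sum k q (\<lambda>z. \<Sum>x\<in>UNIV. q x * \<phi> (z(k := x)))"
    by (simp add: product_sum_def sum_distrib_left mult_ac)
  finally show ?thesis .
qed

lemma product_sum_swap:
  "product_sum k q (\<lambda>z. \<Sum>x\<in>UNIV. c x * \<phi> x z) = (\<Sum>x\<in>UNIV. c x * product_sum k q (\<phi> x))"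
  unfolding product_sum_def sum_distrib_left
  by (subst sum.swap) (simp add: mult_ac)

lemma product_sum_mono:
  assumes "\<And>x. 0 \<le> q x" "\<And>z. \<phi> z \<le> \<psi> z"
  shows "product_sum k q \<phi> \<le> product_sum k q \<psi>"
  unfolding product_sum_def using assms by (intro sum_mono mult_left_mono prod_nonneg) auto

lemma product_sum_const:
  "product_sum k q (\<lambda>_. c) = c * (\<Sum>x\<in>UNIV. q x) ^ k"
  using prod_sum_PiE[of "{..<k}" "\<lambda>_. UNIV" "\<lambda>_. q"]
  by (simp add: product_sum_def sum_distrib_left mult.commute)

text \<open>Replaces the factors one at a time. The statistic \<open>s\<close> confines the hypothesis on
  \<open>q - r\<close> to the events that are measurable with respect to \<open>s\<close>.\<close>
lemma product_sum_hybrid: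
  fixes q r :: "'a::finite \<Rightarrow> real" and s :: "'a \<Rightarrow> 'b" and \<phi> :: "(nat \<Rightarrow> 'b) \<Rightarrow> real"
  assumes q: "\<And>x. 0 \<le> q x" "sum q UNIV \<le> 1"
    and r: "\<And>x. 0 \<le> r x" "sum r UNIV \<le> 1"
    and \<delta>: "0 \<le> \<delta>"
    and close: "\<And>w. w \<in> UNIV \<rightarrow> {0..1} \<Longrightarrow> (\<Sum>x\<in>UNIV. w (s x) * (q x - r x)) \<le> \<delta>"
    and \<phi>: "\<phi> \<in> UNIV \<rightarrow> {0..1}"
  shows "product_sum k q (\<lambda>z. \<phi> (s \<circ> z)) - product_sum k r (\<lambda>z. \<phi> (s \<circ> z)) \<le> real k * \<delta>"
  using \<phi>
proof (induction k arbitrary: \<phi>)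
  case 0
  then show ?case by (simp add: product_sum_0)
next
  case (Suc k)
  define \<phi>' where "\<phi>' = (\<lambda>x u. \<phi> (u(k := s x)))"
  have \<phi>': "\<phi> (s \<circ> z(k := x)) = \<phi>' x (s \<circ> z)" for z x
    by (simp add: \<phi>'_def fun_upd_comp)
  let ?P = "\<lambda>q x. product_sum k q (\<lambda>z. \<phi>' x (s \<circ> z))"
  have IH: "?P q x - ?P r x \<le> real k * \<delta>" for x
    using Suc.prems by (intro Suc.IH) (auto simp: \<phi>'_def Pi_iff)
  \<comment> \<open>With the last coordinate split off, the difference is a \<open>q\<close>-average
    of differences of \<open>k\<close>-fold sums, bounded by induction, plus an
    \<open>r\<close>-average of sums against \<open>q - r\<close>. In the latter the first
    \<open>k\<close> coordinates are fixed, so \<open>\<phi>\<close> depends on \<open>s x\<close>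
    alone and \<open>close\<close> applies. Masses at most 1 keep the errors from growing.\<close>
  have "(\<Sum>x\<in>UNIV. q x * (?P q x - ?P r x)) \<le> (\<Sum>x\<in>UNIV. q x * (real k * \<delta>))"
    using IH q by (intro sum_mono mult_left_mono) auto
  also have "\<dots> \<le> real k * \<delta>"
    using q \<delta> by (simp add: sum_distrib_right[symmetric] mult_left_le_one_le sum_nonneg)
  finally have 1: "(\<Sum>x\<in>UNIV. q x * (?P q x - ?P r x)) \<le> real k * \<delta>" .
  have "(\<Sum>x\<in>UNIV. (q x - r x) * ?P r x)
      = product_sum k r (\<lambda>z. \<Sum>x\<in>UNIV. (q x - r x) * \<phi>' x (s \<circ> z))"
    by (rule product_sum_swap[symmetric])
  also have "\<dots> \<le> product_sum k r (\<lambda>_. \<delta>)"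
  proof (rule product_sum_mono[OF r(1)])
    fix z :: "nat \<Rightarrow> 'a"
    show "(\<Sum>x\<in>UNIV. (q x - r x) * \<phi>' x (s \<circ> z)) \<le> \<delta>"
      using close[of "\<lambda>b. \<phi> ((s \<circ> z)(k := b))"] Suc.prems by (auto simp: \<phi>'_def mult_ac)
  qed
  also have "\<dots> \<le> \<delta>"
    using r \<delta> by (simp add: product_sum_const mult_left_le power_le_one sum_nonneg)
  finally have 2: "(\<Sum>x\<in>UNIV. (q x - r x) * ?P r x) \<le> \<delta>" .
  have "product_sum (Suc k) q (\<lambda>z. \<phi> (s \<circ> z)) - product_sum (Suc k) r (\<lambda>z. \<phi> (s \<circ> z))
      = (\<Sum>x\<in>UNIV. q x * (?P q x - ?P r x)) + (\<Sum>x\<in>UNIV. (q x - r x) * ?P r x)"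
    by (simp add: product_sum_Suc \<phi>' product_sum_swap algebra_simps sum.distrib sum_subtractf)
  moreover have "real (Suc k) * \<delta> = real k * \<delta> + \<delta>" by (simp add: algebra_simps)
  ultimately show ?case using 1 2 by linarith
qed

section \<open>Near-optimality of the threshold test\<close>

text \<open>Bernoulli's inequality, in the form that makes the cost of confusing
  \<open>p ^ k\<close> with \<open>\<epsilon> ^ k\<close> linear in \<open>k\<close>.\<close>

lemma one_minus_ratio_power_le:
  fixes a b c :: real
  assumes "0 < a" "a \<le> b"
  shows "1 - (a / b) ^ k \<le> real k * ((b - a) / b)"
proof -
  have "1 + real k * (a / b - 1) \<le> (1 + (a / b - 1)) ^ k"
    using assms by (intro Bernoulli_inequality) auto
  then show ?thesis using assms by (simp add: diff_divide_distrib algebra_simps)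
qed

text \<open>The test \<open>H > \<epsilon>\<^sup>k\<close> is optimal for the likelihood ratio \<open>H / \<epsilon>\<^sup>k\<close>; the true ratio is
  \<open>H / p\<^sup>k\<close>. The error is charged to the null measure if \<open>\<epsilon> \<le> p\<close> and to the alternative
  otherwise.\<close>
lemma threshold_test_pointwise:
  fixes H f p \<epsilon> \<gamma> :: real
  assumes H: "0 \<le> H" and f: "0 \<le> f" "f \<le> 1" and p: "0 < p" and \<epsilon>: "0 < \<epsilon>"
    and \<gamma>: "\<bar>p - \<epsilon>\<bar> \<le> \<gamma>"
  shows "(f - of_bool (H > \<epsilon> ^ k)) * (H / p ^ k - 1)
      \<le> real k * \<gamma> / \<epsilon> * (if \<epsilon> \<le> p then 1 else H / p ^ k)"
proof (cases "\<epsilon> \<le> p")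
  case True
  have pk: "\<epsilon> ^ k \<le> p ^ k" "0 < p ^ k" using True p \<epsilon> by (auto intro: power_mono)
  have "(p - \<epsilon>) / p \<le> \<gamma> / \<epsilon>" using True \<gamma> \<epsilon> by (intro frac_le) auto
  then have "real k * ((p - \<epsilon>) / p) \<le> real k * (\<gamma> / \<epsilon>)" by (intro mult_left_mono) auto
  then have e: "1 - (\<epsilon> / p) ^ k \<le> real k * \<gamma> / \<epsilon>"
    using one_minus_ratio_power_le[of \<epsilon> p k] True \<epsilon> by simp
  have e0: "0 \<le> real k * \<gamma> / \<epsilon>" using \<gamma> \<epsilon> by simp
  show ?thesis
  proof (cases "H > \<epsilon> ^ k")
    \<comment> \<open>The test accepts although the likelihood ratio may be below 1; it is still at
      least \<open>(\<epsilon> / p) ^ k\<close>.\<close>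
    case A: True
    then have "(\<epsilon> / p) ^ k \<le> H / p ^ k" using pk by (simp add: power_divide divide_right_mono)
    then have "1 - H / p ^ k \<le> real k * \<gamma> / \<epsilon>" using e by linarith
    then have "(1 - f) * (1 - H / p ^ k) \<le> (1 - f) * (real k * \<gamma> / \<epsilon>)"
      using f by (intro mult_left_mono) auto
    also have "\<dots> \<le> real k * \<gamma> / \<epsilon>" using f e0 by (intro mult_left_le_one_le) auto
    finally have "(f - 1) * (H / p ^ k - 1) \<le> real k * \<gamma> / \<epsilon>"
      using minus_mult_minus[of "1 - f" "1 - H / p ^ k"] by simp
    then show ?thesis using A True by simp
  next
    case A: False
    then have "H / p ^ k \<le> 1" using pk by simp
    then have "f * (H / p ^ k - 1) \<le> 0" using f by (intro mult_nonneg_nonpos) auto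
    then show ?thesis using A True e0 by simp
  qed
next
  case False
  have pk: "p ^ k \<le> \<epsilon> ^ k" "0 < p ^ k" "0 < \<epsilon> ^ k" using False p \<epsilon> by (auto intro: power_mono)
  have "(\<epsilon> - p) / \<epsilon> \<le> \<gamma> / \<epsilon>" using False \<gamma> \<epsilon> by (intro divide_right_mono) auto
  then have "real k * ((\<epsilon> - p) / \<epsilon>) \<le> real k * (\<gamma> / \<epsilon>)" by (intro mult_left_mono) auto
  then have e: "1 - (p / \<epsilon>) ^ k \<le> real k * \<gamma> / \<epsilon>"
    using one_minus_ratio_power_le[of p \<epsilon> k] False p by simp
  have e0: "0 \<le> real k * \<gamma> / \<epsilon>" using \<gamma> \<epsilon> by simp
  have L0: "0 \<le> H / p ^ k" using H p by simp
  have rhs: "0 \<le> real k * \<gamma> / \<epsilon> * (H / p ^ k)" using e0 L0 by (rule mult_nonneg_nonneg)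
  show ?thesis
  proof (cases "H > \<epsilon> ^ k")
    case A: True
    then have "1 \<le> H / p ^ k" using pk by simp
    then have "(f - 1) * (H / p ^ k - 1) \<le> 0" using f by (intro mult_nonpos_nonneg) auto
    then show ?thesis using A False rhs by simp
  next
    \<comment> \<open>The test rejects although the ratio may exceed 1, but by a factor of at most
      \<open>(\<epsilon> / p) ^ k\<close>. The excess is thus a small fraction of the ratio itself,
      which is why it is charged to the alternative.\<close>
    case A: False
    have "H / p ^ k * (p / \<epsilon>) ^ k = H / \<epsilon> ^ k" using p by (simp add: power_divide)
    also have "\<dots> \<le> 1" using A pk by simp
    finally have "H / p ^ k - 1 \<le> H / p ^ k * (1 - (p / \<epsilon>) ^ k)" by (simp add: right_diff_distrib)
    also have "\<dots> \<le> H / p ^ k * (real k * \<gamma> / \<epsilon>)" using e L0 by (intro mult_left_mono) auto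
    finally have *: "H / p ^ k - 1 \<le> real k * \<gamma> / \<epsilon> * (H / p ^ k)" by (simp add: mult.commute)
    have "f * (H / p ^ k - 1) \<le> f * (real k * \<gamma> / \<epsilon> * (H / p ^ k))"
      using * f by (intro mult_left_mono) auto
    also have "\<dots> \<le> real k * \<gamma> / \<epsilon> * (H / p ^ k)"
      using f rhs by (intro mult_left_le_one_le) auto
    finally show ?thesis using A False by simp
  qed
qed

text \<open>A Neyman-Pearson argument: the pointwise bound is integrated against the product of
  \<open>d\<close>.\<close>

lemma threshold_test_near_optimal:
  fixes d h :: "'a::finite \<Rightarrow> real"
  assumes d: "\<And>x. 0 \<le> d x" "sum d UNIV = 1" and h: "\<And>x. 0 \<le> h x"
    and p: "p = (\<Sum>x\<in>UNIV. d x * h x)" "0 < p" and \<epsilon>: "0 < \<epsilon>" and \<gamma>: "\<bar>p - \<epsilon>\<bar> \<le> \<gamma>"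
    and f: "f \<in> UNIV \<rightarrow> {0..1}"
  shows "product_sum k (\<lambda>x. d x * h x / p) f - product_sum k d f
    \<le> product_sum k (\<lambda>x. d x * h x / p) (threshold_test h \<epsilon> k)
      - product_sum k d (threshold_test h \<epsilon> k) + real k * \<gamma> / \<epsilon>"
proof -
  let ?T = "PiE {..<k} (\<lambda>_. UNIV :: 'a set)"
  let ?d = "\<lambda>z. \<Prod>i<k. d (z i)" and ?H = "\<lambda>z. \<Prod>i<k. h (z i)"
  let ?t = "threshold_test h \<epsilon> k" and ?q = "\<lambda>x. d x * h x / p"
  let ?e = "real k * \<gamma> / \<epsilon>"
  have dq: "(\<Prod>i<k. ?q (z i)) = ?d z * (?H z / p ^ k)" for z
    by (simp add: prod.distrib prod_dividef)
  have q1: "sum ?q UNIV = 1" using p by (simp flip: sum_divide_distrib)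
  have "product_sum k ?q f - product_sum k d f - (product_sum k ?q ?t - product_sum k d ?t)
      = (\<Sum>z\<in>?T. ?d z * ((f z - ?t z) * (?H z / p ^ k - 1)))"
    unfolding product_sum_def dq sum_subtractf[symmetric]
    by (intro sum.cong refl) (simp add: algebra_simps diff_divide_distrib)
  also have "\<dots> \<le> (\<Sum>z\<in>?T. ?d z * (?e * (if \<epsilon> \<le> p then 1 else ?H z / p ^ k)))"
  proof (intro sum_mono mult_left_mono)
    fix z
    show "(f z - ?t z) * (?H z / p ^ k - 1) \<le> ?e * (if \<epsilon> \<le> p then 1 else ?H z / p ^ k)"
      unfolding threshold_test_def
      using f h p \<epsilon> \<gamma> by (intro threshold_test_pointwise) (auto intro: prod_nonneg)
    show "0 \<le> ?d z" using d by (intro prod_nonneg) auto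
  qed
  \<comment> \<open>Both \<open>d\<close> and \<open>?q\<close> have total mass 1, so the error is
    the same whichever of the two measures it is charged to.\<close>
  also have "\<dots> = ?e"
  proof (cases "\<epsilon> \<le> p")
    case True
    then have "?thesis \<longleftrightarrow> product_sum k d (\<lambda>_. ?e) = ?e" by (simp add: product_sum_def)
    then show ?thesis by (simp add: product_sum_const d)
  next
    case False
    then have "?thesis \<longleftrightarrow> product_sum k ?q (\<lambda>_. ?e) = ?e"
      unfolding product_sum_def dq by (simp add: mult_ac)
    then show ?thesis by (simp add: product_sum_const q1)
  qed
  finally show ?thesis by linarith
qed

text \<open>The inequality \<open>y \<le> exp (y - 1)\<close> is used twice, in the role of the
  comparison of geometric and arithmetic means: with \<open>y = u i / \<epsilon>\<close> the large
  product forces the sum of the \<open>u i\<close> above \<open>k * \<epsilon>\<close>, and with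
  \<open>y = (1 - u i) / (1 - \<epsilon>)\<close> this sum bounds the other product.\<close>

lemma prod_one_minus_le:
  fixes u :: "nat \<Rightarrow> real"
  assumes \<epsilon>: "0 < \<epsilon>" "\<epsilon> < 1" and u: "\<And>i. 0 \<le> u i" "\<And>i. u i \<le> 1"
    and big: "(\<Prod>i<k. u i) > \<epsilon> ^ k"
  shows "(\<Prod>i<k. 1 - u i) \<le> (1 - \<epsilon>) ^ k"
proof -
  have "1 < (\<Prod>i<k. u i / \<epsilon>)" using big \<epsilon> by (simp add: prod_dividef)
  also have "\<dots> \<le> (\<Prod>i<k. exp (u i / \<epsilon> - 1))"
  proof (intro prod_mono conjI)
    fix i
    show "0 \<le> u i / \<epsilon>" using u \<epsilon> by simp
    show "u i / \<epsilon> \<le> exp (u i / \<epsilon> - 1)" using exp_ge_add_one_self[of "u i / \<epsilon> - 1"] by simp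
  qed
  also have "\<dots> = exp ((\<Sum>i<k. u i - \<epsilon>) / \<epsilon>)"
    using \<epsilon> by (simp add: exp_sum[symmetric] sum_divide_distrib diff_divide_distrib)
  finally have S: "0 < (\<Sum>i<k. u i - \<epsilon>)" using \<epsilon> by (simp add: zero_less_divide_iff)
  have "(\<Prod>i<k. (1 - u i) / (1 - \<epsilon>)) \<le> (\<Prod>i<k. exp ((1 - u i) / (1 - \<epsilon>) - 1))"
  proof (intro prod_mono conjI)
    fix i
    show "0 \<le> (1 - u i) / (1 - \<epsilon>)" using u \<epsilon> by simp
    show "(1 - u i) / (1 - \<epsilon>) \<le> exp ((1 - u i) / (1 - \<epsilon>) - 1)"
      using exp_ge_add_one_self[of "(1 - u i) / (1 - \<epsilon>) - 1"] by simp
  qed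
  also have "\<dots> = exp (- (\<Sum>i<k. u i - \<epsilon>) / (1 - \<epsilon>))"
  proof -
    have "(1 - u i) / (1 - \<epsilon>) - 1 = - (u i - \<epsilon>) / (1 - \<epsilon>)" for i
      using \<epsilon> by (simp add: field_simps)
    then show ?thesis by (simp add: exp_sum[symmetric] sum_divide_distrib flip: sum_negf)
  qed
  also have "\<dots> \<le> 1" using S \<epsilon> by (simp add: divide_nonpos_pos)
  finally show ?thesis using \<epsilon> by (simp add: prod_dividef)
qed

section \<open>Bounds on the total variation distance\<close>

text \<open>A one-sided bound suffices, since passing to the complement of an event flips the sign
  of the difference.\<close>

lemma tv_dist_power_le:
  fixes P Q :: "'a::finite pmf"
  assumes "\<And>f. f \<in> UNIV \<rightarrow> {0..1} \<Longrightarrow> product_sum k (pmf Q) f - product_sum k (pmf P) f \<le> B"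
  shows "tv_dist (power_pmf k P) (power_pmf k Q) \<le> B"
  unfolding tv_dist_def
proof (rule cSUP_least)
  fix A :: "(nat \<Rightarrow> 'a) set"
  have prob: "measure_pmf.prob (power_pmf k D) S = product_sum k (pmf D) (indicator S)"
    for D :: "'a pmf" and S
    by (simp flip: expectation_power_pmf)
  have *: "measure_pmf.prob (power_pmf k Q) S - measure_pmf.prob (power_pmf k P) S \<le> B" for S
    unfolding prob by (rule assms) (auto simp: indicator_def)
  have compl: "measure_pmf.prob (power_pmf k D) (- A) = 1 - measure_pmf.prob (power_pmf k D) A"
    for D :: "'a pmf"
    using measure_pmf.prob_compl[of A "power_pmf k D"] by (simp add: Compl_eq_Diff_UNIV)
  show "\<bar>measure_pmf.prob (power_pmf k P) A - measure_pmf.prob (power_pmf k Q) A\<bar> \<le> B"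
    using *[of A] *[of "- A"] by (simp add: compl)
qed simp

lemma tv_dist_le_1: "tv_dist P Q \<le> 1"
  unfolding tv_dist_def
proof (rule cSUP_least)
  fix A
  have "0 \<le> measure_pmf.prob P A" "measure_pmf.prob P A \<le> 1"
    "0 \<le> measure_pmf.prob Q A" "measure_pmf.prob Q A \<le> 1"
    by simp_all
  then show "\<bar>measure_pmf.prob P A - measure_pmf.prob Q A\<bar> \<le> 1" by linarith
qed simp


theorem theorem4p2:
  fixes F :: "('a::finite \<Rightarrow> real) set"
    and D0 D1 DX D1' :: "'a pmf"
    and \<epsilon> \<gamma> :: real
    and g h :: "'a \<Rightarrow> real"
    and k :: nat
  assumes F: "F \<subseteq> UNIV \<rightarrow> {0..1}"
    and eps: "\<epsilon> \<in> {0<..<1}"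
    and gamma: "\<gamma> \<in> {0<..<\<epsilon> / 2}"
    and h: "h \<in> UNIV \<rightarrow> {0..1}"
    and DX: "DX = mixture_pmf \<epsilon> D0 D1"
    and g: "\<forall>x\<in>set_pmf DX. g x = \<epsilon> * pmf D1 x / ((1 - \<epsilon>) * pmf D0 x + \<epsilon> * pmf D1 x)"
    and D1': "D1' = positive_pmf DX h"
    and regular: "regular_simulator F (\<epsilon>\<^sup>2) DX g h"
    and calibrated: "calibrated_simulator \<gamma> DX g h"
  shows "indistinguishable F (\<epsilon> + 2 * \<gamma> / \<epsilon>\<^sup>2) D1 D1' \<and>
    \<bar>measure_pmf.expectation (power_pmf k D0) (threshold_test h \<epsilon> k)
      - measure_pmf.expectation (power_pmf k D1) (threshold_test h \<epsilon> k)\<bar>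
      \<ge> tv_dist (power_pmf k D0) (power_pmf k D1')
          - (2 * \<gamma> / \<epsilon>\<^sup>2 + \<gamma> / \<epsilon> + \<epsilon>) * real k"
proof -

  \<comment> \<open>Weights of the distributions, and closeness of \<open>D1\<close> and
    \<open>D1'\<close>\<close>
  have \<epsilon>: "0 < \<epsilon>" "\<epsilon> < 1" and \<gamma>: "0 < \<gamma>" "\<gamma> < \<epsilon> / 2" using eps gamma by auto
  have h01: "0 \<le> h x" "h x \<le> 1" for x using h by auto
  define d where "d = pmf DX"
  define p where "p = measure_pmf.expectation DX h"
  let ?t = "threshold_test h \<epsilon> k"
  have d: "d x = (1 - \<epsilon>) * pmf D0 x + \<epsilon> * pmf D1 x" for x
    unfolding d_def DX using \<epsilon> by (simp add: pmf_mixture)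
  have d0: "0 \<le> d x" for x by (simp add: d_def)
  have d1: "sum d UNIV = 1" by (simp add: d_def sum_pmf_UNIV)
  have p: "p = (\<Sum>x\<in>UNIV. d x * h x)" by (simp add: p_def d_def expectation_pmf_finite)
  \<comment> \<open>This holds off the support of \<open>DX\<close> as well, where \<open>g\<close>
    is arbitrary but both sides vanish.\<close>
  have dg: "d x * g x = \<epsilon> * pmf D1 x" for x
  proof (cases "d x = 0")
    case True
    have "0 \<le> (1 - \<epsilon>) * pmf D0 x" "0 \<le> \<epsilon> * pmf D1 x" using \<epsilon> by auto
    with True have "\<epsilon> * pmf D1 x = 0" unfolding d by linarith
    with True show ?thesis by simp
  next
    case False
    then have "x \<in> set_pmf DX" by (simp add: d_def set_pmf_iff)
    then show ?thesis using g False by (simp flip: d)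
  qed
  have DX_gh: "measure_pmf.expectation DX (\<lambda>x. f x * (g x - h x))
      = (\<Sum>x\<in>UNIV. f x * (\<epsilon> * pmf D1 x - d x * h x))" for f
    unfolding expectation_pmf_finite
    by (intro sum.cong refl) (simp flip: dg d_def add: algebra_simps)
  have cal: "\<bar>\<Sum>x\<in>UNIV. w (h x) * (\<epsilon> * pmf D1 x - d x * h x)\<bar> \<le> \<gamma>"
    if "w \<in> UNIV \<rightarrow> {0..1}" for w
    using calibrated that unfolding calibrated_simulator_def DX_gh by (auto simp: Pi_iff)
  have p\<epsilon>: "\<bar>p - \<epsilon>\<bar> \<le> \<gamma>"
    using cal[of "\<lambda>_. 1"] by (simp add: sum_subtractf sum_distrib_left[symmetric] sum_pmf_UNIV p abs_minus_commute)
  \<comment> \<open>Here \<open>\<gamma> < \<epsilon> / 2\<close> ensures that label 1 has positive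
    probability, so that \<open>D1'\<close> is a genuine conditional law.\<close>
  then have p0: "0 < p" using \<gamma> \<epsilon> by linarith
  have pD1': "pmf D1' = (\<lambda>x. d x * h x / p)"
    unfolding D1' using pmf_positive[OF h, of DX] p0 by (auto simp: p_def d_def)
  \<comment> \<open>Up to the normalisation error \<open>(p - \<epsilon>) * pmf D1' x\<close>, the
    weight \<open>\<epsilon> * (pmf D1 x - pmf D1' x)\<close> is the one that the hypotheses
    control. The bound \<open>\<eta>\<close> is \<open>\<epsilon>\<^sup>2\<close> for regularity and
    \<open>\<gamma>\<close> for calibration.\<close>
  have D1_close: "\<bar>\<Sum>x\<in>UNIV. v x * (pmf D1 x - pmf D1' x)\<bar> \<le> \<eta> / \<epsilon> + \<gamma> / \<epsilon>"
    if v: "v \<in> UNIV \<rightarrow> {0..1}" and \<eta>: "\<bar>\<Sum>x\<in>UNIV. v x * (\<epsilon> * pmf D1 x - d x * h x)\<bar> \<le> \<eta>" for v \<eta>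
  proof -
    let ?S = "\<Sum>x\<in>UNIV. v x * pmf D1' x"
    have v01: "0 \<le> v x" "v x \<le> 1" for x using v by auto
    have S0: "0 \<le> ?S" using v01 by (intro sum_nonneg) auto
    have "?S \<le> (\<Sum>x\<in>UNIV. pmf D1' x)" using v01 by (intro sum_mono mult_left_le_one_le) auto
    then have S1: "?S \<le> 1" by (simp add: sum_pmf_UNIV)
    have "v x * (\<epsilon> * (pmf D1 x - pmf D1' x))
        = v x * (\<epsilon> * pmf D1 x - d x * h x) + (p - \<epsilon>) * (v x * pmf D1' x)" for x
      unfolding pD1' using p0 by (simp add: field_simps)
    then have "\<epsilon> * (\<Sum>x\<in>UNIV. v x * (pmf D1 x - pmf D1' x))
        = (\<Sum>x\<in>UNIV. v x * (\<epsilon> * pmf D1 x - d x * h x)) + (p - \<epsilon>) * ?S"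
      by (simp only: sum_distrib_left sum.distrib[symmetric] mult.left_commute[of \<epsilon>])
    moreover have "\<bar>(p - \<epsilon>) * ?S\<bar> \<le> \<gamma>"
      using mult_mono[OF p\<epsilon> S1] S0 \<gamma> by (simp add: abs_mult)
    ultimately have "\<bar>\<epsilon> * (\<Sum>x\<in>UNIV. v x * (pmf D1 x - pmf D1' x))\<bar> \<le> \<eta> + \<gamma>"
      using \<eta> by linarith
    then show ?thesis using \<epsilon> by (simp add: abs_mult field_simps)
  qed

  \<comment> \<open>Indistinguishability from regularity\<close>
  have "indistinguishable F (\<epsilon> + 2 * \<gamma> / \<epsilon>\<^sup>2) D1 D1'"
    unfolding indistinguishable_def
  proof
    fix f assume f: "f \<in> F"
    have "\<bar>\<Sum>x\<in>UNIV. f x * (\<epsilon> * pmf D1 x - d x * h x)\<bar> \<le> \<epsilon>\<^sup>2"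
      using regular f unfolding regular_simulator_def DX_gh by auto
    from D1_close[OF _ this]
    have "\<bar>\<Sum>x\<in>UNIV. f x * (pmf D1 x - pmf D1' x)\<bar> \<le> \<epsilon>\<^sup>2 / \<epsilon> + \<gamma> / \<epsilon>" using F f by auto
    also have "\<dots> \<le> \<epsilon> + 2 * \<gamma> / \<epsilon>\<^sup>2"
      using \<epsilon> \<gamma> by (simp add: power2_eq_square field_simps)
    finally show "\<bar>measure_pmf.expectation D1 f - measure_pmf.expectation D1' f\<bar> \<le> \<epsilon> + 2 * \<gamma> / \<epsilon>\<^sup>2"
      by (simp add: expectation_pmf_finite sum_subtractf algebra_simps)
  qed

  \<comment> \<open>Advantage of the threshold test on \<open>k\<close> samples\<close>
  moreover
  \<comment> \<open>The test sees \<open>z\<close> only through \<open>h \<circ> z\<close>, so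
    calibration can serve as the hypothesis of the hybrid argument.\<close>
  define \<phi> where "\<phi> = (\<lambda>u :: nat \<Rightarrow> real. of_bool ((\<Prod>i<k. u i) > \<epsilon> ^ k) :: real)"
  have t: "?t = (\<lambda>z. \<phi> (h \<circ> z))" by (auto simp: threshold_test_def \<phi>_def)
  have \<phi>: "\<phi> \<in> UNIV \<rightarrow> {0..1}" by (auto simp: \<phi>_def)
  define X where "X = product_sum k (pmf D1) ?t"
  define Y where "Y = product_sum k (pmf D0) ?t"
  define Z where "Z = product_sum k d ?t"
  \<comment> \<open>The bound \<open>2 * \<gamma> / \<epsilon>\<close> is sharper than the
    \<open>2 * \<gamma> / \<epsilon>\<^sup>2\<close> of the claim; the slack later pays for
    comparing \<open>D0\<close> with \<open>DX\<close> on the test.\<close>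
  have D1_t: "product_sum k (pmf D1') ?t - X \<le> real k * (2 * \<gamma> / \<epsilon>)"
    unfolding X_def t
  proof (rule product_sum_hybrid[OF _ _ _ _ _ _ \<phi>])
    fix w :: "real \<Rightarrow> real" assume w: "w \<in> UNIV \<rightarrow> {0..1}"
    have "\<bar>\<Sum>x\<in>UNIV. w (h x) * (pmf D1 x - pmf D1' x)\<bar> \<le> \<gamma> / \<epsilon> + \<gamma> / \<epsilon>"
      using w by (intro D1_close cal) auto
    then show "(\<Sum>x\<in>UNIV. w (h x) * (pmf D1' x - pmf D1 x)) \<le> 2 * \<gamma> / \<epsilon>"
      by (simp add: right_diff_distrib sum_subtractf)
  qed (use \<epsilon> \<gamma> in \<open>auto simp: sum_pmf_UNIV\<close>)
  \<comment> \<open>An arbitrary \<open>f\<close> has to be covered here, hence the statistic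
    \<open>id\<close>.\<close>
  have D0_DX: "product_sum k d f - product_sum k (pmf D0) f \<le> real k * \<epsilon>"
    if f: "f \<in> UNIV \<rightarrow> {0..1}" for f
  proof -
    have "product_sum k d (\<lambda>z. f (id \<circ> z)) - product_sum k (pmf D0) (\<lambda>z. f (id \<circ> z)) \<le> real k * \<epsilon>"
    proof (rule product_sum_hybrid[OF _ _ _ _ _ _ f])
      fix w :: "'a \<Rightarrow> real" assume w: "w \<in> UNIV \<rightarrow> {0..1}"
      then have w01: "0 \<le> w x" "w x \<le> 1" for x by auto
      have "w x * (d x - pmf D0 x) \<le> \<epsilon> * pmf D1 x" for x
      proof -
        have "w x * (d x - pmf D0 x) = w x * (\<epsilon> * pmf D1 x) - w x * (\<epsilon> * pmf D0 x)"
          by (simp add: d algebra_simps)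
        also have "\<dots> \<le> w x * (\<epsilon> * pmf D1 x)" using w01 \<epsilon> by simp
        also have "\<dots> \<le> \<epsilon> * pmf D1 x" using w01 \<epsilon> by (intro mult_left_le_one_le) auto
        finally show ?thesis .
      qed
      then have "(\<Sum>x\<in>UNIV. w x * (d x - pmf D0 x)) \<le> (\<Sum>x\<in>UNIV. \<epsilon> * pmf D1 x)"
        by (intro sum_mono)
      then show "(\<Sum>x\<in>UNIV. w (id x) * (d x - pmf D0 x)) \<le> \<epsilon>"
        by (simp add: sum_distrib_left[symmetric] sum_pmf_UNIV)
    qed (use \<epsilon> d0 d1 in \<open>auto simp: sum_pmf_UNIV\<close>)
    then show ?thesis by simp
  qed
  have tv: "tv_dist (power_pmf k D0) (power_pmf k D1')
      \<le> X - Z + real k * (2 * \<gamma> / \<epsilon>) + real k * \<gamma> / \<epsilon> + real k * \<epsilon>"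
  proof (rule tv_dist_power_le)
    fix f :: "(nat \<Rightarrow> 'a) \<Rightarrow> real" assume f: "f \<in> UNIV \<rightarrow> {0..1}"
    have "product_sum k (pmf D1') f - product_sum k d f
        \<le> product_sum k (pmf D1') ?t - Z + real k * \<gamma> / \<epsilon>"
      unfolding pD1' Z_def by (rule threshold_test_near_optimal[OF d0 d1 h01(1) p p0 \<epsilon>(1) p\<epsilon> f])
    with D0_DX[OF f] D1_t
    show "product_sum k (pmf D1') f - product_sum k (pmf D0) f
        \<le> X - Z + real k * (2 * \<gamma> / \<epsilon>) + real k * \<gamma> / \<epsilon> + real k * \<epsilon>"
      by linarith
  qed
  have err: "(2 * \<gamma> / \<epsilon>\<^sup>2 + \<gamma> / \<epsilon> + \<epsilon>) * real k
      = real k * (2 * \<gamma> / \<epsilon>\<^sup>2) + real k * \<gamma> / \<epsilon> + real k * \<epsilon>"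
    by (simp add: algebra_simps)
  have "\<bar>Y - X\<bar> \<ge> tv_dist (power_pmf k D0) (power_pmf k D1')
      - (2 * \<gamma> / \<epsilon>\<^sup>2 + \<gamma> / \<epsilon> + \<epsilon>) * real k"
  proof (cases "k \<le> 1")
    case True
    text \<open>For a single sample the mixture identity is exact, so \<open>\<epsilon>\<close> may be close to 1.\<close>
    have "X - Z = (if k = 0 then 0 else (1 - \<epsilon>) * (X - Y))"
    proof (cases "k = 0")
      case True
      then show ?thesis by (simp add: X_def Z_def product_sum_0)
    next
      case False
      then have k: "k = Suc 0" using \<open>k \<le> 1\<close> by simp
      show ?thesis
        by (simp add: X_def Y_def Z_def k product_sum_Suc product_sum_0 d sum_distrib_left
            algebra_simps flip: sum_subtractf sum.distrib)
    qed
    moreover have "\<bar>(1 - \<epsilon>) * (X - Y)\<bar> \<le> \<bar>X - Y\<bar>"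
      using \<epsilon> by (simp add: abs_mult mult_left_le_one_le)
    ultimately have XZ: "X - Z \<le> \<bar>Y - X\<bar>" by (cases "k = 0") auto
    have "2 * \<gamma> / \<epsilon> \<le> 2 * \<gamma> / \<epsilon>\<^sup>2"
      using \<epsilon> \<gamma> by (simp add: power2_eq_square field_simps)
    then have "real k * (2 * \<gamma> / \<epsilon>) \<le> real k * (2 * \<gamma> / \<epsilon>\<^sup>2)" by (intro mult_left_mono) auto
    then show ?thesis using tv XZ err by linarith
  next
    case k: False
    show ?thesis
    \<comment> \<open>If \<open>k * \<epsilon>\<close> is at least 1, the lower bound is at most 0
      and the claim is trivial. Otherwise \<open>k \<ge> 2\<close> gives
      \<open>\<epsilon> \<le> 1 / 2\<close>.\<close>
    proof (cases "1 \<le> real k * \<epsilon>")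
      case True
      have "0 \<le> (2 * \<gamma> / \<epsilon>\<^sup>2 + \<gamma> / \<epsilon>) * real k" using \<epsilon> \<gamma> by simp
      then show ?thesis
        using tv_dist_le_1[of "power_pmf k D0" "power_pmf k D1'"] True by (simp add: algebra_simps)
    next
      case False
      have "2 * \<epsilon> \<le> real k * \<epsilon>" using k \<epsilon> by (intro mult_right_mono) auto
      then have half: "\<epsilon> \<le> 1 / 2" using False by linarith
      \<comment> \<open>The ideal normalisation is \<open>1 - \<epsilon>\<close>. The maximum also
        keeps the mass of \<open>n\<close> at most 1, and exceeds \<open>1 - \<epsilon>\<close> by
        at most \<open>\<gamma>\<close>.\<close>
      define c where "c = max (1 - \<epsilon>) (1 - p)"
      define n where "n = (\<lambda>x. d x * (1 - h x) / c)"
      have c: "0 < c" "1 - \<epsilon> \<le> c" "1 - p \<le> c" "c - (1 - \<epsilon>) \<le> \<gamma>"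
        using \<epsilon> \<gamma> p\<epsilon> by (auto simp: c_def)
      have n0: "0 \<le> n x" for x using d0 h01 c by (simp add: n_def)
      have dh: "(\<Sum>x\<in>UNIV. d x * (1 - h x)) = 1 - p"
        by (simp add: right_diff_distrib sum_subtractf d1 p)
      have n1: "sum n UNIV \<le> 1"
        using c by (simp add: n_def dh flip: sum_divide_distrib)
      have "product_sum k n ?t \<le> Z"
        unfolding Z_def product_sum_def
      proof (rule sum_mono)
        fix z :: "nat \<Rightarrow> 'a"
        show "(\<Prod>i<k. n (z i)) * ?t z \<le> (\<Prod>i<k. d (z i)) * ?t z"
        proof (cases "(\<Prod>i<k. h (z i)) > \<epsilon> ^ k")
          case True
          have "(\<Prod>i<k. 1 - h (z i)) \<le> (1 - \<epsilon>) ^ k" using \<epsilon> h01 True by (rule prod_one_minus_le)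
          also have "\<dots> \<le> c ^ k" using c \<epsilon> by (intro power_mono) auto
          finally have "(\<Prod>i<k. 1 - h (z i)) / c ^ k \<le> 1" using c by simp
          moreover have "0 \<le> (\<Prod>i<k. d (z i))" using d0 by (intro prod_nonneg) auto
          ultimately have "(\<Prod>i<k. d (z i)) * ((\<Prod>i<k. 1 - h (z i)) / c ^ k) \<le> (\<Prod>i<k. d (z i))"
            by (rule mult_left_le)
          then show ?thesis
            using True by (simp add: threshold_test_def n_def prod.distrib prod_dividef)
        qed (simp add: threshold_test_def)
      qed
      \<comment> \<open>Calibration and the choice of \<open>c\<close> each cost
        \<open>\<gamma>\<close>; dividing by \<open>1 - \<epsilon> \<ge> 1 / 2\<close> doubles the
        sum.\<close>
      moreover have "Y - product_sum k n ?t \<le> real k * (4 * \<gamma>)"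
        unfolding Y_def t
      proof (rule product_sum_hybrid[OF _ _ n0 n1 _ _ \<phi>])
        fix w :: "real \<Rightarrow> real" assume w: "w \<in> UNIV \<rightarrow> {0..1}"
        then have w01: "0 \<le> w y" "w y \<le> 1" for y by auto
        let ?D = "\<Sum>x\<in>UNIV. w (h x) * (pmf D0 x - n x)"
        have "(\<Sum>x\<in>UNIV. w (h x) * n x) \<le> sum n UNIV"
          using w01 n0 by (intro sum_mono mult_left_le_one_le) auto
        then have n_le: "(\<Sum>x\<in>UNIV. w (h x) * n x) \<le> 1" using n1 by linarith
        have "w (h x) * ((1 - \<epsilon>) * (pmf D0 x - n x))
            = (c - (1 - \<epsilon>)) * (w (h x) * n x) - w (h x) * (\<epsilon> * pmf D1 x - d x * h x)" for x
        proof -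
          have "c * n x = d x * (1 - h x)" using c by (simp add: n_def)
          moreover have "(1 - \<epsilon>) * pmf D0 x = d x - \<epsilon> * pmf D1 x" by (simp add: d)
          ultimately have "(1 - \<epsilon>) * (pmf D0 x - n x)
              = (c - (1 - \<epsilon>)) * n x - (\<epsilon> * pmf D1 x - d x * h x)"
            by (simp add: algebra_simps)
          then show ?thesis by (simp only:) (simp add: algebra_simps)
        qed
        then have "(1 - \<epsilon>) * ?D = (c - (1 - \<epsilon>)) * (\<Sum>x\<in>UNIV. w (h x) * n x)
            - (\<Sum>x\<in>UNIV. w (h x) * (\<epsilon> * pmf D1 x - d x * h x))"
          by (simp only: sum_distrib_left sum_subtractf[symmetric] mult.left_commute[of "1 - \<epsilon>"])
        moreover have "(c - (1 - \<epsilon>)) * (\<Sum>x\<in>UNIV. w (h x) * n x) \<le> \<gamma>"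
          using mult_left_le[OF n_le, of "c - (1 - \<epsilon>)"] c by linarith
        ultimately have *: "(1 - \<epsilon>) * ?D \<le> 2 * \<gamma>" using cal[OF w] by linarith
        show "?D \<le> 4 * \<gamma>"
        proof (cases "0 \<le> ?D")
          case True
          then have "1 / 2 * ?D \<le> (1 - \<epsilon>) * ?D" using half by (intro mult_right_mono) auto
          then show ?thesis using * by linarith
        qed (use \<gamma> in linarith)
      qed (use \<gamma> in \<open>auto simp: sum_pmf_UNIV\<close>)
      ultimately have YZ: "Y - real k * (4 * \<gamma>) \<le> Z" by linarith
      \<comment> \<open>The slack kept in \<open>D1_t\<close> absorbs \<open>4 * \<gamma>\<close>,
        precisely because \<open>\<epsilon> \<le> 1 / 2\<close>.\<close>
      have "2 * \<gamma> / \<epsilon> + 4 * \<gamma> \<le> 2 * \<gamma> / \<epsilon>\<^sup>2"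
      proof -
        have "0 \<le> (1 - 2 * \<epsilon>) * (1 + \<epsilon>)" using \<epsilon> half by simp
        then have "0 \<le> 1 - \<epsilon> - 2 * (\<epsilon> * \<epsilon>)" by (simp add: algebra_simps)
        then have "0 \<le> 2 * \<gamma> * (1 - \<epsilon> - 2 * (\<epsilon> * \<epsilon>)) / \<epsilon>\<^sup>2" using \<gamma> by simp
        also have "\<dots> = 2 * \<gamma> / \<epsilon>\<^sup>2 - 2 * \<gamma> / \<epsilon> - 4 * \<gamma>"
          using \<epsilon> by (simp add: power2_eq_square field_simps)
        finally show ?thesis by simp
      qed
      then have "real k * (2 * \<gamma> / \<epsilon> + 4 * \<gamma>) \<le> real k * (2 * \<gamma> / \<epsilon>\<^sup>2)"
        by (intro mult_left_mono) auto
      then have "real k * (2 * \<gamma> / \<epsilon>) + real k * (4 * \<gamma>) \<le> real k * (2 * \<gamma> / \<epsilon>\<^sup>2)"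
        by (simp only: distrib_left)
      then show ?thesis using tv YZ err by linarith
    qed
  qed
  ultimately show ?thesis
    unfolding expectation_power_pmf X_def Y_def by blast
qed

end
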